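(* Let $s=\sigma+it$ with $\sigma,t$ real, and let $\zeta$ be the Riemann zeta function. (1) If $\sigma\ge0$, $|s-1|\ge2$ and $x$ is a real number with $0<x\le|s|$, then $$\Bigl|\zeta(s)-\sum_{1\le n\le x}\frac{1}{n^s}\Bigr|\le 7|s|x^{-\sigma}.$$ (2) If $\sigma>1$ and $x>0$ is real, then $$\Bigl|\zeta(s)-\sum_{1\le n\le x}\frac{1}{n^{s}}\Bigr|\le \frac{x^{1-\sigma}}{\sigma-1}\Bigl(1+\frac{\sigma-1}{x}\Bigr).$$
   Context: Sums run over positive integers $n$ (an empty sum is $0$). *)

theory Defs
  imports "HOL-Complex_Analysis.Complex_Analysis"
begin

text \<open>
  The Riemann zeta function: the analytic continuation to \<open>\<complex> - {1}\<close> of the Dirichlet series.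
  Uniqueness follows from the identity theorem, since \<open>\<complex> - {1}\<close> is connected. The condition
  \<open>f 1 = 0\<close> merely fixes a dummy value at the pole so that \<open>f\<close> is unique as a total function.
\<close>

definition riemann_zeta :: "complex \<Rightarrow> complex" where
  "riemann_zeta = (THE f.
     f holomorphic_on (- {1}) \<and>
     (\<forall>s. Re s > 1 \<longrightarrow> f s = (\<Sum>n. 1 / of_nat (Suc n) powr s)) \<and>
     f 1 = 0)"

end

theory Submission imports Defs begin

text \<open>
  Write \<open>\<zeta>(s, a)\<close> for the Hurwitz zeta function. The function \<open>Z(s, a) = (s - 1) \<zeta>(s, a)\<close> satisfies
  \<open>Z(s, a) = a\<^sup>1\<^sup>-\<^sup>s + (s - 1) \<integral>\<^sub>0\<^sup>1 (1 - y) Z(s + 1, a + y) dy\<close> for \<open>Re s > 1\<close>. Reading the right-hand side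
  as a definition continues \<open>Z\<close> one unit further to the left each time, without meeting a pole, and
  so yields \<open>\<zeta>(s) = Z(s, 1) / (s - 1)\<close> on the whole punctured plane; moreover
  \<open>\<zeta>(s) - (\<Sum>n<N. n\<^sup>-\<^sup>s) = Z(s, N) / (s - 1)\<close>, the sum starting at \<open>1\<close>.
  For (1), take \<open>N = \<lfloor>|s|\<rfloor> + 1\<close>, apply the recursion twice and estimate \<open>Z(s + 2, \<cdot>)\<close> by its
  absolutely convergent series: this gives \<open>6 |s| N\<^sup>-\<^sup>\<sigma>\<close>. The at most \<open>|s|\<close> terms with
  \<open>x < n < N\<close> contribute at most \<open>|s| x\<^sup>-\<^sup>\<sigma>\<close>. Part (2) is the comparison of the tail with an integral.
\<close>

text \<open>The level \<open>m\<close> version is meaningful for \<open>Re s > 1 - m\<close> and \<open>a > 0\<close>.\<close>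

primrec zeta_reg :: "nat \<Rightarrow> complex \<Rightarrow> real \<Rightarrow> complex" where
  "zeta_reg 0 s a = (s - 1) * (\<Sum>n. of_real (a + real n) powr (- s))"
| "zeta_reg (Suc m) s a = of_real a powr (1 - s) +
     (s - 1) * integral {0..1} (\<lambda>y. of_real (1 - y) * zeta_reg m (s + 1) (a + y))"

section \<open>Powers of positive reals and convergence of the Hurwitz series\<close>

lemma norm_of_real_powr: "0 < a \<Longrightarrow> norm (of_real a powr z :: complex) = a powr Re z"
  by (simp add: norm_powr_real_powr)

text \<open>On a positive real base the power is \<open>exp\<close> of the exponent times a real
  logarithm, so the branch cut of \<open>Ln\<close> never interferes and base and exponent may vary
  together.\<close>

lemma continuous_on_of_real_powr:
  fixes f :: "'a::topological_space \<Rightarrow> complex" and g :: "'a \<Rightarrow> real"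
  assumes "continuous_on A f" "continuous_on A g" "\<And>x. x \<in> A \<Longrightarrow> 0 < g x"
  shows "continuous_on A (\<lambda>x. complex_of_real (g x) powr f x)"
proof -
  have "continuous_on A (\<lambda>x. exp (f x * of_real (ln (g x))))"
    using assms by (auto intro!: continuous_intros simp: less_imp_neq[symmetric])
  moreover have "complex_of_real (g x) powr f x = exp (f x * of_real (ln (g x)))" if "x \<in> A" for x
    using assms(3)[OF that] by (simp add: powr_def Ln_of_real)
  ultimately show ?thesis by (simp cong: continuous_on_cong)
qed

lemma summable_hurwitz_real:
  fixes a \<sigma> :: real
  assumes "0 < a" "1 < \<sigma>"
  shows "summable (\<lambda>n. (a + real n) powr (- \<sigma>))"
\<comment> \<open>The comparison must skip \<open>n = 0\<close>: there the majorant is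
  \<open>0 powr _ = 0\<close>, while the term itself is positive.\<close>
proof (rule summable_comparison_test'[where N = 1])
  show "summable (\<lambda>n. real n powr (- \<sigma>))"
    using assms by (simp add: summable_real_powr_iff)
  show "norm ((a + real n) powr (- \<sigma>)) \<le> real n powr (- \<sigma>)" if "1 \<le> n" for n
    using that assms by (simp add: powr_mono2')
qed

lemma summable_hurwitz:
  assumes "0 < a" "1 < Re s"
  shows "summable (\<lambda>n. complex_of_real (a + real n) powr (- s))"
proof (rule summable_norm_cancel)
  have "norm (complex_of_real (a + real n) powr (- s)) = (a + real n) powr (- Re s)" for n
    using assms by (subst norm_of_real_powr) auto
  then show "summable (\<lambda>n. norm (complex_of_real (a + real n) powr (- s)))"
    using summable_hurwitz_real[OF assms] by simp
qed

text \<open>Comparison with the integral of \<open>z powr (- \<sigma>)\<close>: by the mean value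
  theorem each term after the first is dominated by a difference of values of
  \<open>b powr (1 - \<sigma>)\<close>, and these differences telescope. The first term is kept
  separately.\<close>

lemma hurwitz_tail_real:
  fixes a \<sigma> :: real
  assumes "0 < a" "1 < \<sigma>"
  shows "(\<Sum>n. (a + real n) powr (- \<sigma>)) \<le> a powr (- \<sigma>) + a powr (1 - \<sigma>) / (\<sigma> - 1)"
proof -
  have step: "(\<sigma> - 1) * (b + 1) powr (- \<sigma>) \<le> b powr (1 - \<sigma>) - (b + 1) powr (1 - \<sigma>)"
    if b: "0 < b" for b :: real
  proof -
    have "\<exists>z>b. z < b + 1 \<and> (b + 1) powr (1 - \<sigma>) - b powr (1 - \<sigma>)
            = (b + 1 - b) * ((1 - \<sigma>) * z powr (1 - \<sigma> - 1))"
      using b by (intro MVT2) (auto intro!: derivative_eq_intros)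
    then obtain z where z: "b < z" "z < b + 1"
      and eq: "(b + 1) powr (1 - \<sigma>) - b powr (1 - \<sigma>) = (1 - \<sigma>) * z powr (- \<sigma>)"
      by auto
    have "(b + 1) powr (- \<sigma>) \<le> z powr (- \<sigma>)"
      using z b assms by (intro powr_mono2') auto
    then have "(\<sigma> - 1) * (b + 1) powr (- \<sigma>) \<le> (\<sigma> - 1) * z powr (- \<sigma>)"
      using assms by (intro mult_left_mono) auto
    then show ?thesis using eq by (simp add: algebra_simps)
  qed
  have part: "(\<sigma> - 1) * (\<Sum>n<N. (a + real (Suc n)) powr (- \<sigma>))
      \<le> a powr (1 - \<sigma>) - (a + real N) powr (1 - \<sigma>)" for N
  proof (induction N)
    case (Suc N)
    then show ?case
      using step[of "a + real N"] assms by (simp add: distrib_left add_ac)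
  qed simp
  have S: "summable (\<lambda>n. (a + real (Suc n)) powr (- \<sigma>))"
    using summable_hurwitz_real[OF assms] by (subst summable_Suc_iff)
  have "(\<Sum>n. (a + real (Suc n)) powr (- \<sigma>)) \<le> a powr (1 - \<sigma>) / (\<sigma> - 1)"
  proof (rule suminf_le_const[OF S])
    fix N
    have "(\<sigma> - 1) * (\<Sum>n<N. (a + real (Suc n)) powr (- \<sigma>)) \<le> a powr (1 - \<sigma>)"
      using part[of N] powr_ge_zero[of "a + real N" "1 - \<sigma>"] by linarith
    then show "(\<Sum>n<N. (a + real (Suc n)) powr (- \<sigma>)) \<le> a powr (1 - \<sigma>) / (\<sigma> - 1)"
      using assms by (simp add: pos_le_divide_eq mult.commute)
  qed
  then show ?thesis
    using suminf_split_head[OF summable_hurwitz_real[OF assms]] by simp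
qed

lemma norm_hurwitz_le:
  assumes "0 < a" "1 < Re s"
  shows "norm (\<Sum>n. complex_of_real (a + real n) powr (- s))
    \<le> a powr (- Re s) + a powr (1 - Re s) / (Re s - 1)"
proof -
  have "norm (\<Sum>n. complex_of_real (a + real n) powr (- s)) \<le> (\<Sum>n. (a + real n) powr (- Re s))"
  proof (rule norm_suminf_le)
    show "norm (complex_of_real (a + real n) powr (- s)) \<le> (a + real n) powr (- Re s)" for n
      using assms by (subst norm_of_real_powr) auto
  qed (rule summable_hurwitz_real[OF assms])
  then show ?thesis using hurwitz_tail_real[OF assms] by linarith
qed

section \<open>Uniform convergence in both variables and termwise differentiation\<close>

text \<open>For \<open>n \<ge> 1\<close> the majorant is independent of \<open>a\<close>, so
  uniformity reaches down to \<open>a = 0\<close>. The term \<open>n = 0\<close> is unbounded there,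
  but the eventual form of the M-test ignores it.\<close>

lemma uniform_limit_hurwitz:
  fixes d :: real
  assumes "0 < d"
  shows "uniform_limit ({s. 1 + d < Re s} \<times> {0<..})
    (\<lambda>N p. \<Sum>n<N. complex_of_real (snd p + real n) powr (- fst p))
    (\<lambda>p. \<Sum>n. complex_of_real (snd p + real n) powr (- fst p)) sequentially"
proof (rule Weierstrass_m_test_ev[where M = "\<lambda>n. real n powr (- 1 - d)"])
  show "\<forall>\<^sub>F n in sequentially. \<forall>p\<in>{s. 1 + d < Re s} \<times> {0<..}.
      norm (complex_of_real (snd p + real n) powr (- fst p)) \<le> real n powr (- 1 - d)"
  proof (rule eventually_sequentiallyI[of 1], safe)
    fix n :: nat and s :: complex and a :: real
    assume n: "1 \<le> n" and s: "1 + d < Re s" and a: "0 < a"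
    have "norm (complex_of_real (a + real n) powr (- s)) = (a + real n) powr (- Re s)"
      using a by (subst norm_of_real_powr) auto
    also have "\<dots> \<le> (a + real n) powr (- 1 - d)"
      using n s a by (intro powr_mono) auto
    also have "\<dots> \<le> real n powr (- 1 - d)"
      using n a assms by (intro powr_mono2') auto
    finally show "norm (complex_of_real (snd (s, a) + real n) powr (- fst (s, a)))
        \<le> real n powr (- 1 - d)" by simp
  qed
qed (use assms in \<open>simp add: summable_real_powr_iff\<close>)

lemma uniform_limit_hurwitz_deriv:
  fixes d :: real
  assumes "0 < d"
  shows "uniform_limit ({s. 1 + d < Re s} \<times> {0<..})
    (\<lambda>N p. \<Sum>n<N. - of_real (ln (snd p + real n)) * complex_of_real (snd p + real n) powr (- fst p))
    (\<lambda>p. \<Sum>n. - of_real (ln (snd p + real n)) * complex_of_real (snd p + real n) powr (- fst p))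
    sequentially"
proof (rule Weierstrass_m_test_ev[where M = "\<lambda>n. 2 / d * real n powr (- 1 - d / 2)"])
  show "\<forall>\<^sub>F n in sequentially. \<forall>p\<in>{s. 1 + d < Re s} \<times> {0<..}.
      norm (- of_real (ln (snd p + real n)) * complex_of_real (snd p + real n) powr (- fst p))
      \<le> 2 / d * real n powr (- 1 - d / 2)"
  proof (rule eventually_sequentiallyI[of 1], safe)
    fix n :: nat and s :: complex and a :: real
    assume n: "1 \<le> n" and s: "1 + d < Re s" and a: "0 < a"
    let ?b = "a + real n"
    have b: "1 \<le> ?b" using n a by simp
    have e: "d / 2 + (- 1 - d) = - 1 - d / 2" by simp
    have split: "?b powr (- 1 - d / 2) = ?b powr (d / 2) * ?b powr (- 1 - d)"
      unfolding e[symmetric] by (rule powr_add)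
    have "norm (- of_real (ln ?b) * complex_of_real ?b powr (- s)) = ln ?b * ?b powr (- Re s)"
      using b by (simp only: norm_mult norm_minus_cancel norm_of_real) (subst norm_of_real_powr, auto)
    \<comment> \<open>Half of the margin \<open>d\<close> is spent on absorbing the logarithm; the
      other half keeps the majorant summable.\<close>
    also have "\<dots> \<le> (?b powr (d / 2) / (d / 2)) * ?b powr (- 1 - d)"
      using b s assms by (intro mult_mono ln_powr_bound powr_mono) auto
    also have "\<dots> = 2 / d * ?b powr (- 1 - d / 2)"
      by (simp add: split)
    also have "\<dots> \<le> 2 / d * real n powr (- 1 - d / 2)"
    proof (rule mult_left_mono)
      show "?b powr (- 1 - d / 2) \<le> real n powr (- 1 - d / 2)"
        using n a assms by (intro powr_mono2') auto
    qed (use assms in simp)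
    finally show "norm (- of_real (ln (snd (s, a) + real n)) *
        complex_of_real (snd (s, a) + real n) powr (- fst (s, a)))
        \<le> 2 / d * real n powr (- 1 - d / 2)" by simp
  qed
qed (use assms in \<open>intro summable_mult, simp add: summable_real_powr_iff\<close>)

text \<open>Continuity on an open union can be checked on each open piece, so estimates with a fixed
  margin \<open>d\<close> suffice on the whole half-plane.\<close>

lemma half_plane_Times_UN: "{s. 1 < Re s} \<times> {0::real<..} = (\<Union>d\<in>{0<..}. {s. 1 + d < Re s} \<times> {0<..})"
  (is "?A = ?B")
proof
  show "?A \<subseteq> ?B"
  proof safe
    fix s :: complex and a :: real assume "1 < Re s" "a > 0"
    then have "1 + (Re s - 1) / 2 < Re s" "(Re s - 1) / 2 \<in> {0<..}" by (auto simp: field_simps)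
    then show "(s, a) \<in> ?B" using \<open>a > 0\<close> by blast
  qed
qed auto

lemma continuous_on_hurwitz:
  "continuous_on ({s. 1 < Re s} \<times> {0<..})
    (\<lambda>p. \<Sum>n. complex_of_real (snd p + real n) powr (- fst p))"
  unfolding half_plane_Times_UN
proof (rule continuous_on_open_UN)
  fix d :: real assume "d \<in> {0<..}"
  then show "continuous_on ({s. 1 + d < Re s} \<times> {0<..})
     (\<lambda>p. \<Sum>n. complex_of_real (snd p + real n) powr (- fst p))"
    by (intro uniform_limit_theorem[OF _ uniform_limit_hurwitz] always_eventually allI
          continuous_intros continuous_on_of_real_powr) (auto simp: add_pos_nonneg)
qed (intro open_Times open_halfspace_Re_gt open_greaterThan)

lemma continuous_on_hurwitz_deriv:
  "continuous_on ({s. 1 < Re s} \<times> {0<..})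
    (\<lambda>p. \<Sum>n. - of_real (ln (snd p + real n)) * complex_of_real (snd p + real n) powr (- fst p))"
  unfolding half_plane_Times_UN
proof (rule continuous_on_open_UN)
  fix d :: real assume "d \<in> {0<..}"
  then show "continuous_on ({s. 1 + d < Re s} \<times> {0<..})
     (\<lambda>p. \<Sum>n. - of_real (ln (snd p + real n)) * complex_of_real (snd p + real n) powr (- fst p))"
    by (intro uniform_limit_theorem[OF _ uniform_limit_hurwitz_deriv] always_eventually allI
          continuous_intros continuous_on_of_real_powr) (auto simp: add_pos_nonneg)
qed (intro open_Times open_halfspace_Re_gt open_greaterThan)

lemma has_field_derivative_hurwitz:
  assumes "0 < a" "1 < Re s"
  shows "((\<lambda>s. \<Sum>n. complex_of_real (a + real n) powr (- s)) has_field_derivative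
    (\<Sum>n. - of_real (ln (a + real n)) * complex_of_real (a + real n) powr (- s))) (at s)"
proof -
  define d where "d = (Re s - 1) / 2"
  have d: "0 < d" "1 + d < Re s" using assms by (auto simp: d_def field_simps)
  let ?S = "{s. 1 + d < Re s}"
  have u: "uniform_limit ?S
     (\<lambda>N s. \<Sum>n<N. - of_real (ln (a + real n)) * complex_of_real (a + real n) powr (- s))
     (\<lambda>s. \<Sum>n. - of_real (ln (a + real n)) * complex_of_real (a + real n) powr (- s)) sequentially"
    using uniform_limit_compose'[OF uniform_limit_hurwitz_deriv[OF d(1)], of "\<lambda>s. (s, a)" ?S] assms
    by (auto simp: )
  obtain g where g: "\<And>x. x \<in> ?S \<Longrightarrow> (\<lambda>n. complex_of_real (a + real n) powr (- x)) sums g x"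
    "\<And>x. x \<in> ?S \<Longrightarrow> (g has_field_derivative
      (\<Sum>n. - of_real (ln (a + real n)) * complex_of_real (a + real n) powr (- x))) (at x within ?S)"
  proof -
    have "\<exists>g. \<forall>x\<in>?S. (\<lambda>n. complex_of_real (a + real n) powr (- x)) sums g x \<and>
      (g has_field_derivative
      (\<Sum>n. - of_real (ln (a + real n)) * complex_of_real (a + real n) powr (- x))) (at x within ?S)"
    proof (rule has_field_derivative_series[OF _ _ u])
      show "convex ?S" by (rule convex_halfspace_Re_gt)
      show "((\<lambda>s. complex_of_real (a + real n) powr (- s)) has_field_derivative
        - of_real (ln (a + real n)) * complex_of_real (a + real n) powr (- x)) (at x within ?S)" for n x
      proof -
        have "complex_of_real (a + real n) \<noteq> 0" using assms by (simp only: of_real_eq_0_iff)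
        moreover have "Ln (complex_of_real (a + real n)) = of_real (ln (a + real n))"
          using assms by (intro Ln_of_real) auto
        ultimately show ?thesis
          unfolding powr_def by (auto intro!: derivative_eq_intros)
      qed
      show "s \<in> ?S" using d by simp
      show "summable (\<lambda>n. complex_of_real (a + real n) powr (- s))"
        by (rule summable_hurwitz[OF assms])
    qed
    then show ?thesis using that by blast
  qed
  have "open ?S" by (rule open_halfspace_Re_gt)
  have s: "s \<in> ?S" using d by simp
  show ?thesis
  proof (rule has_field_derivative_transform_within_open[where f = g and S = ?S])
    show "(g has_field_derivative
        (\<Sum>n. - of_real (ln (a + real n)) * complex_of_real (a + real n) powr (- s))) (at s)"
      using g(2)[OF s] by (simp only: at_within_open[OF s \<open>open ?S\<close>])
    show "g x = (\<Sum>n. complex_of_real (a + real n) powr (- x))" if "x \<in> ?S" for x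
      using sums_unique[OF g(1)[OF that]] .
  qed fact+
qed

section \<open>The recursion under the integral sign: an explicit integral and regularity of all
  levels\<close>

text \<open>This is the integral of the recursion applied to the single summand
  \<open>s * (a + y) powr (- (s + 1))\<close>, by which two values at \<open>s + 1\<close> differ
  when the real parameter grows by one. The primitive \<open>?F\<close> comes from integration by
  parts.\<close>

lemma has_integral_powr_first_difference:
  assumes "0 < a"
  shows "((\<lambda>y. (s - 1) * (of_real (1 - y) * (s * complex_of_real (a + y) powr (- (s + 1))))) has_integral
    of_real (a + 1) powr (1 - s) + (s - 1) * of_real a powr (- s) - of_real a powr (1 - s)) {0..1}"
proof -
  let ?F = "\<lambda>z. - (s - 1) * (1 - z) * (of_real a + z) powr (- s) + (of_real a + z) powr (1 - s)"
  have "((\<lambda>y. (s - 1) * (of_real (1 - y) * (s * complex_of_real (a + y) powr (- (s + 1))))) has_integral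
    ?F (of_real 1) - ?F (of_real 0)) {0..1}"
  proof (rule fundamental_theorem_of_calculus)
    fix y :: real assume y: "y \<in> {0..1}"
    have "(?F has_field_derivative
        (s - 1) * (of_real (1 - y) * (s * complex_of_real (a + y) powr (- (s + 1)))))
        (at (of_real y))"
    proof -
      have nz: "of_real a + complex_of_real y \<notin> \<real>\<^sub>\<le>\<^sub>0"
        using y assms by (simp add: complex_nonpos_Reals_iff)
      have e: "- s - 1 = - (s + 1)" "1 - s - 1 = - s" by auto
      have "(?F has_field_derivative
         - (s - 1) * ((1 - of_real y) * (- s * (of_real a + of_real y) powr (- s - 1)) +
            (- 1) * (of_real a + of_real y) powr (- s))
         + (1 - s) * (of_real a + of_real y) powr (1 - s - 1)) (at (of_real y))"
        using nz by (auto intro!: derivative_eq_intros simp: algebra_simps)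
      then show ?thesis unfolding e by (simp add: algebra_simps)
    qed
    then show "((\<lambda>y. ?F (of_real y)) has_vector_derivative
        (s - 1) * (of_real (1 - y) * (s * complex_of_real (a + y) powr (- (s + 1)))))
        (at y within {0..1})"
      by (rule has_vector_derivative_real_field)
  qed simp
  then show ?thesis by (simp add: algebra_simps)
qed

lemma continuous_on_shifted_integrand:
  fixes f :: "complex \<Rightarrow> real \<Rightarrow> complex"
  assumes "continuous_on ({s. c < Re s} \<times> {0<..}) (\<lambda>p. f (fst p) (snd p))"
  shows "continuous_on (({s. c - 1 < Re s} \<times> {0<..}) \<times> cbox 0 1)
    (\<lambda>(p, y). of_real (1 - y) * f (fst p + 1) (snd p + y))"
proof -
  have "continuous_on (({s. c - 1 < Re s} \<times> {0<..}) \<times> cbox 0 1)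
    (\<lambda>q. f (fst (fst (fst q) + 1, snd (fst q) + snd q)) (snd (fst (fst q) + 1, snd (fst q) + snd q)))"
    by (rule continuous_on_compose2[OF assms]) (auto intro!: continuous_intros)
  then show ?thesis
    by (auto simp: case_prod_unfold intro!: continuous_intros)
qed

text \<open>Differentiation under the integral sign requires the derivative of the integrand to be
  jointly continuous, so the induction carries joint continuity of both the function and its
  derivative in \<open>s\<close>. The next derivative then follows from the product rule.\<close>

lemma zeta_reg_regular:
  "continuous_on ({s. 1 - real m < Re s} \<times> {0<..}) (\<lambda>p. zeta_reg m (fst p) (snd p)) \<and>
   (\<exists>D. continuous_on ({s. 1 - real m < Re s} \<times> {0<..}) (\<lambda>p. D (fst p) (snd p)) \<and>
     (\<forall>s a. 1 - real m < Re s \<longrightarrow> 0 < a \<longrightarrow> ((\<lambda>s. zeta_reg m s a) has_field_derivative D s a) (at s)))"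
proof (induction m)
  case 0
  let ?H = "\<lambda>s a. \<Sum>n. complex_of_real (a + real n) powr (- s)"
  let ?H' = "\<lambda>s a. \<Sum>n. - of_real (ln (a + real n)) * complex_of_real (a + real n) powr (- s)"
  let ?D = "\<lambda>s a. ?H s a + (s - 1) * ?H' s a"
  have "continuous_on ({s. 1 - real 0 < Re s} \<times> {0<..}) (\<lambda>p. ?D (fst p) (snd p))"
    using continuous_on_hurwitz continuous_on_hurwitz_deriv by (auto intro!: continuous_intros)
  moreover have "((\<lambda>s. zeta_reg 0 s a) has_field_derivative ?D s a) (at s)" if "1 < Re s" "0 < a" for s a
    using has_field_derivative_hurwitz[OF that(2,1)]
    by (auto intro!: derivative_eq_intros simp del: of_real_add)
  moreover have "continuous_on ({s. 1 - real 0 < Re s} \<times> {0<..}) (\<lambda>p. zeta_reg 0 (fst p) (snd p))"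
    using continuous_on_hurwitz by (auto intro!: continuous_intros)
  ultimately show ?case by (intro conjI exI[of _ ?D]) auto
next
  case (Suc m)
  then obtain D where Z: "continuous_on ({s. 1 - real m < Re s} \<times> {0<..}) (\<lambda>p. zeta_reg m (fst p) (snd p))"
    and D: "continuous_on ({s. 1 - real m < Re s} \<times> {0<..}) (\<lambda>p. D (fst p) (snd p))"
    and deriv: "\<And>s a. 1 - real m < Re s \<Longrightarrow> 0 < a \<Longrightarrow> ((\<lambda>s. zeta_reg m s a) has_field_derivative D s a) (at s)"
    by blast
  define U where "U = {s. 1 - real (Suc m) < Re s}"
  have U: "U = {s. (1 - real m) - 1 < Re s}" "open U" "convex U"
    by (auto simp: U_def open_halfspace_Re_gt convex_halfspace_Re_gt)
  define I where "I = (\<lambda>s a. integral (cbox 0 1) (\<lambda>y. of_real (1 - y) * zeta_reg m (s + 1) (a + y)))"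
  define J where "J = (\<lambda>s a. integral (cbox 0 1) (\<lambda>y. of_real (1 - y) * D (s + 1) (a + y)))"
  note cZ = continuous_on_shifted_integrand[OF Z, folded U(1)]
  note cD = continuous_on_shifted_integrand[OF D, folded U(1)]
  have cI: "continuous_on (U \<times> {0<..}) (\<lambda>p. I (fst p) (snd p))"
    unfolding I_def by (rule integral_continuous_on_param[OF cZ])
  have cJ: "continuous_on (U \<times> {0<..}) (\<lambda>p. J (fst p) (snd p))"
    unfolding J_def by (rule integral_continuous_on_param[OF cD])
  have derI: "((\<lambda>s. I s a) has_field_derivative J s a) (at s)" if s: "s \<in> U" and a: "0 < a" for s a
  proof -
    have "((\<lambda>s. I s a) has_field_derivative J s a) (at s within U)"
      unfolding I_def J_def
    proof (rule leibniz_rule_field_derivative[OF _ _ _ s U(3)])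
      fix x t assume x: "x \<in> U" and t: "t \<in> cbox (0::real) 1"
      have "((\<lambda>x. zeta_reg m (x + 1) (a + t)) has_field_derivative D (x + 1) (a + t) * 1) (at x within U)"
        using x t a by (intro DERIV_chain2[OF deriv]) (auto simp: U_def intro!: derivative_eq_intros)
      then have "((\<lambda>x. zeta_reg m (x + 1) (a + t)) has_field_derivative D (x + 1) (a + t)) (at x within U)"
        by simp
      then show "((\<lambda>x. of_real (1 - t) * zeta_reg m (x + 1) (a + t)) has_field_derivative
          of_real (1 - t) * D (x + 1) (a + t)) (at x within U)"
        by (rule DERIV_cmult)
    next
      fix x assume x: "x \<in> U"
      have "continuous_on (cbox 0 1) (\<lambda>y. (\<lambda>(p, y). of_real (1 - y) * zeta_reg m (fst p + 1) (snd p + y)) ((x, a), y))"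
        using x a by (intro continuous_on_compose2[OF cZ]) (auto intro!: continuous_intros)
      then show "(\<lambda>y. of_real (1 - y) * zeta_reg m (x + 1) (a + y)) integrable_on cbox 0 1"
        by (intro integrable_continuous) simp
    next
      have "continuous_on (U \<times> cbox 0 1) (\<lambda>q. (\<lambda>(p, y). of_real (1 - y) * D (fst p + 1) (snd p + y)) ((fst q, a), snd q))"
        using a by (intro continuous_on_compose2[OF cD]) (auto intro!: continuous_intros)
      then show "continuous_on (U \<times> cbox 0 1) (\<lambda>(x, t). of_real (1 - t) * D (x + 1) (a + t))"
        by (simp add: case_prod_unfold)
    qed
    then show ?thesis by (simp only: at_within_open[OF s U(2)])
  qed
  let ?D = "\<lambda>s a. - of_real (ln a) * of_real a powr (1 - s) + (I s a + (s - 1) * J s a)"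
  have eq: "zeta_reg (Suc m) s a = of_real a powr (1 - s) + (s - 1) * I s a" for s a
    by (simp only: zeta_reg.simps I_def cbox_interval)
  have "continuous_on (U \<times> {0<..}) (\<lambda>p. zeta_reg (Suc m) (fst p) (snd p))"
    unfolding eq using cI by (intro continuous_intros continuous_on_of_real_powr) auto
  moreover have "continuous_on (U \<times> {0<..}) (\<lambda>p. ?D (fst p) (snd p))"
    using cI cJ by (intro continuous_intros continuous_on_of_real_powr) auto
  moreover have "((\<lambda>s. zeta_reg (Suc m) s a) has_field_derivative ?D s a) (at s)"
    if s: "s \<in> U" and a: "0 < a" for s a
  proof -
    have "((\<lambda>s. complex_of_real a powr (1 - s)) has_field_derivative
        - of_real (ln a) * of_real a powr (1 - s)) (at s)"
      using a unfolding powr_def by (auto intro!: derivative_eq_intros simp: Ln_of_real)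
    moreover have "((\<lambda>s. (s - 1) * I s a) has_field_derivative I s a + (s - 1) * J s a) (at s)"
      using derI[OF s a] by (auto intro!: derivative_eq_intros)
    ultimately show ?thesis unfolding eq by (rule DERIV_add)
  qed
  ultimately show ?case unfolding U_def[symmetric]
    by (intro conjI exI[of _ ?D]) (auto simp: U_def)
qed

lemma continuous_on_zeta_reg_integrand:
  assumes "1 - real (Suc m) < Re s" "0 < a"
  shows "continuous_on {0..1} (\<lambda>y. of_real (1 - y) * zeta_reg m (s + 1) (a + y))"
proof -
  have Z: "continuous_on ({s. 1 - real m < Re s} \<times> {0<..}) (\<lambda>p. zeta_reg m (fst p) (snd p))"
    using zeta_reg_regular by blast
  have "continuous_on {0..1} (\<lambda>y. zeta_reg m (fst (s + 1, a + y)) (snd (s + 1, a + y)))"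
    by (rule continuous_on_compose2[OF Z]) (use assms in \<open>auto intro!: continuous_intros\<close>)
  then show ?thesis by (auto intro!: continuous_intros)
qed

section \<open>The shift equation in the real parameter\<close>

text \<open>At level \<open>0\<close> the first summand is split off. At a successor level the
  induction hypothesis at \<open>s + 1\<close> is used under the integral; the extra summand
  integrates explicitly, and its boundary terms exchange the leading power of \<open>a\<close> for
  that of \<open>a + 1\<close>.\<close>

lemma zeta_reg_shift:
  assumes "1 - real m < Re s" "0 < a"
  shows "zeta_reg m s a = (s - 1) * of_real a powr (- s) + zeta_reg m s (a + 1)"
  using assms
proof (induction m arbitrary: s a)
  case 0
  have "(\<Sum>n. complex_of_real (a + 1 + real n) powr (- s))
      = (\<Sum>n. complex_of_real (a + real n) powr (- s)) - of_real a powr (- s)"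
    using suminf_split_head[OF summable_hurwitz[of a s]] 0 by (simp add: add_ac)
  then show ?case
    by (simp only: zeta_reg.simps) (simp add: algebra_simps)
next
  case (Suc m)
  have int: "(\<lambda>y. of_real (1 - y) * zeta_reg m (s + 1) (b + y)) integrable_on {0..1}" if "0 < b" for b
    using continuous_on_zeta_reg_integrand[OF Suc.prems(1) that] by (rule integrable_continuous_interval)
  have A: "((\<lambda>y. (s - 1) * (of_real (1 - y) * (s * complex_of_real (a + y) powr (- (s + 1)))) +
        (s - 1) * (of_real (1 - y) * zeta_reg m (s + 1) (a + 1 + y))) has_integral
      (of_real (a + 1) powr (1 - s) + (s - 1) * of_real a powr (- s) - of_real a powr (1 - s)) +
      (s - 1) * integral {0..1} (\<lambda>y. of_real (1 - y) * zeta_reg m (s + 1) (a + 1 + y))) {0..1}"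
    using Suc.prems int[of "a + 1"]
    by (intro has_integral_add has_integral_powr_first_difference has_integral_mult_right integrable_integral) auto
  have E: "(s - 1) * (of_real (1 - y) * (s * complex_of_real (a + y) powr (- (s + 1)))) +
        (s - 1) * (of_real (1 - y) * zeta_reg m (s + 1) (a + 1 + y))
      = (s - 1) * (of_real (1 - y) * zeta_reg m (s + 1) (a + y))" if "y \<in> {0..1}" for y
  proof -
    have "zeta_reg m (s + 1) (a + y) = (s + 1 - 1) * of_real (a + y) powr (- (s + 1)) + zeta_reg m (s + 1) (a + y + 1)"
      using Suc.prems that by (intro Suc.IH) auto
    moreover have "a + y + 1 = a + 1 + y" "s + 1 - 1 = s" by auto
    ultimately have "zeta_reg m (s + 1) (a + y) = s * of_real (a + y) powr (- (s + 1)) + zeta_reg m (s + 1) (a + 1 + y)"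
      by simp
    then show ?thesis by (simp only: distrib_left)
  qed
  have "((\<lambda>y. (s - 1) * (of_real (1 - y) * zeta_reg m (s + 1) (a + y))) has_integral
      (of_real (a + 1) powr (1 - s) + (s - 1) * of_real a powr (- s) - of_real a powr (1 - s)) +
      (s - 1) * integral {0..1} (\<lambda>y. of_real (1 - y) * zeta_reg m (s + 1) (a + 1 + y))) {0..1}"
    by (rule has_integral_eq[OF E A])
  moreover have "((\<lambda>y. (s - 1) * (of_real (1 - y) * zeta_reg m (s + 1) (a + y))) has_integral
      (s - 1) * integral {0..1} (\<lambda>y. of_real (1 - y) * zeta_reg m (s + 1) (a + y))) {0..1}"
    using int[of a] Suc.prems by (intro has_integral_mult_right integrable_integral) auto
  ultimately have "(s - 1) * integral {0..1} (\<lambda>y. of_real (1 - y) * zeta_reg m (s + 1) (a + y)) =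
      (of_real (a + 1) powr (1 - s) + (s - 1) * of_real a powr (- s) - of_real a powr (1 - s)) +
      (s - 1) * integral {0..1} (\<lambda>y. of_real (1 - y) * zeta_reg m (s + 1) (a + 1 + y))"
    by (rule has_integral_unique[rotated])
  moreover have "p + (q + r - p + t) = r + (q + t)" for p q r t :: complex
    by simp
  ultimately show ?case by (simp only: zeta_reg.simps)
qed

lemma zeta_reg_shift_nat:
  assumes "1 - real m < Re s" "0 < a"
  shows "zeta_reg m s a = (s - 1) * (\<Sum>n<N. of_real (a + real n) powr (- s)) + zeta_reg m s (a + real N)"
proof (induction N)
  case (Suc N)
  have "zeta_reg m s (a + real N) = (s - 1) * of_real (a + real N) powr (- s) + zeta_reg m s (a + real N + 1)"
    using assms by (intro zeta_reg_shift) auto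
  moreover have "a + real N + 1 = a + real (Suc N)" by simp
  ultimately show ?case
    by (simp only: Suc.IH sum.lessThan_Suc distrib_left add.assoc)
qed simp

section \<open>Norm bounds and independence of the level\<close>

lemma norm_zeta_reg_0_le:
  assumes "0 < a" "1 < Re s"
  shows "norm (zeta_reg 0 s a) \<le> norm (s - 1) * (a powr (- Re s) + a powr (1 - Re s) / (Re s - 1))"
  unfolding zeta_reg.simps norm_mult
  by (rule mult_left_mono[OF norm_hurwitz_le[OF assms]]) simp

lemma norm_zeta_reg_Suc_le:
  assumes "1 - real (Suc m) < Re s" "0 < a"
    and B: "\<And>y. 0 \<le> y \<Longrightarrow> y \<le> 1 \<Longrightarrow> norm (zeta_reg m (s + 1) (a + y)) \<le> B"
  shows "norm (zeta_reg (Suc m) s a) \<le> a powr (1 - Re s) + norm (s - 1) * B"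
proof -
  let ?I = "integral {0..1} (\<lambda>y. of_real (1 - y) * zeta_reg m (s + 1) (a + y))"
  have "norm ?I \<le> B * (1 - 0)"
  proof (rule integral_bound)
    fix y :: real assume y: "y \<in> {0..1}"
    \<comment> \<open>The weight \<open>1 - y\<close> is only bounded by \<open>1\<close>, not
      integrated to \<open>1 / 2\<close>.\<close>
    have "norm (of_real (1 - y) * zeta_reg m (s + 1) (a + y)) \<le> 1 * B"
      unfolding norm_mult norm_of_real using y by (intro mult_mono B) auto
    then show "norm (of_real (1 - y) * zeta_reg m (s + 1) (a + y)) \<le> B" by simp
  qed (use continuous_on_zeta_reg_integrand[OF assms(1,2)] in simp_all)
  then have "norm ((s - 1) * ?I) \<le> norm (s - 1) * B"
    unfolding norm_mult by (intro mult_left_mono) auto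
  moreover have "norm (of_real a powr (1 - s) :: complex) = a powr (1 - Re s)"
    using norm_of_real_powr[OF assms(2)] by simp
  ultimately show ?thesis
    unfolding zeta_reg.simps using norm_triangle_ineq[of "of_real a powr (1 - s)" "(s - 1) * ?I"] by linarith
qed

text \<open>
  Both sides change by the same amount under \<open>a \<mapsto> a + 1\<close>, so their difference is the same at all
  \<open>a + N\<close>; it vanishes because both sides tend to \<open>0\<close> as \<open>a \<rightarrow> \<infinity>\<close>.
\<close>

lemma zeta_reg_1_eq_0:
  assumes s: "1 < Re s" and a: "0 < a"
  shows "zeta_reg (Suc 0) s a = zeta_reg 0 s a"
proof -
  define \<sigma> where "\<sigma> = Re s"
  define B0 where "B0 = (\<lambda>b. norm (s - 1) * (b powr (- \<sigma>) + b powr (1 - \<sigma>) / (\<sigma> - 1)))"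
  \<comment> \<open>\<open>B1\<close> inserts the level \<open>0\<close> bound at
    \<open>s + 1\<close> into one step of the recursion. All exponents in \<open>B0\<close> and
    \<open>B1\<close> are negative because \<open>1 < \<sigma>\<close>.\<close>
  define B1 where "B1 = (\<lambda>b. b powr (1 - \<sigma>) + norm (s - 1) * (norm s * (b powr (- \<sigma> - 1) + b powr (- \<sigma>) / \<sigma>)))"
  have \<sigma>: "1 < \<sigma>" using s by (simp add: \<sigma>_def)
  have b0: "norm (zeta_reg 0 s b) \<le> B0 b" if "0 < b" for b
    using norm_zeta_reg_0_le[OF that s] by (simp only: B0_def \<sigma>_def)
  have b1: "norm (zeta_reg (Suc 0) s b) \<le> B1 b" if b: "0 < b" for b
    unfolding B1_def \<sigma>_def
  proof (rule norm_zeta_reg_Suc_le)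
    fix y :: real assume y: "0 \<le> y" "y \<le> 1"
    have "norm (zeta_reg 0 (s + 1) (b + y)) \<le> norm (s + 1 - 1) *
        ((b + y) powr (- Re (s + 1)) + (b + y) powr (1 - Re (s + 1)) / (Re (s + 1) - 1))"
      using y b s by (intro norm_zeta_reg_0_le) auto
    also have "\<dots> = norm s * ((b + y) powr (- Re s - 1) + (b + y) powr (- Re s) / Re s)"
      by simp
    also have "\<dots> \<le> norm s * (b powr (- Re s - 1) + b powr (- Re s) / Re s)"
      using y b s by (intro mult_left_mono add_mono divide_right_mono powr_mono2') auto
    finally show "norm (zeta_reg 0 (s + 1) (b + y)) \<le> norm s * (b powr (- Re s - 1) + b powr (- Re s) / Re s)" .
  qed (use b s in auto)
  have lim: "filterlim (\<lambda>N. a + real N) at_top sequentially"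
    by (intro filterlim_tendsto_add_at_top[OF tendsto_const] filterlim_real_sequentially)
  have p: "(\<lambda>N. (a + real N) powr r) \<longlonglongrightarrow> 0" if "r < 0" for r
    using that lim by (rule tendsto_neg_powr)
  have "(\<lambda>N. B1 (a + real N) + B0 (a + real N)) \<longlonglongrightarrow>
      (0 + norm (s - 1) * (norm s * (0 + 0 / \<sigma>))) + norm (s - 1) * (0 + 0 / (\<sigma> - 1))"
    unfolding B0_def B1_def using \<sigma> by (intro tendsto_intros p) auto
  moreover have "norm (zeta_reg (Suc 0) s a - zeta_reg 0 s a) \<le> B1 (a + real N) + B0 (a + real N)" for N
  proof -
    have "zeta_reg (Suc 0) s a - zeta_reg 0 s a = zeta_reg (Suc 0) s (a + real N) - zeta_reg 0 s (a + real N)"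
      using zeta_reg_shift_nat[of "Suc 0" s a N] zeta_reg_shift_nat[of 0 s a N] s a
      by (simp del: zeta_reg.simps)
    moreover have "norm (zeta_reg (Suc 0) s (a + real N) - zeta_reg 0 s (a + real N)) \<le> B1 (a + real N) + B0 (a + real N)"
      using a by (intro order_trans[OF norm_triangle_ineq4] add_mono b0 b1) auto
    ultimately show ?thesis by simp
  qed
  ultimately have "norm (zeta_reg (Suc 0) s a - zeta_reg 0 s a) \<le> 0"
    by (intro LIMSEQ_le_const[of _ 0]) (auto simp del: zeta_reg.simps)
  then show ?thesis by (simp del: zeta_reg.simps)
qed

text \<open>The recursion at \<open>s\<close> only sees the lower level at \<open>s + 1\<close>, so
  agreement of two consecutive levels moves one unit to the left with each induction step.\<close>

lemma zeta_reg_Suc_eq: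
  assumes "1 - real m < Re s" "0 < a"
  shows "zeta_reg (Suc m) s a = zeta_reg m s a"
  using assms
proof (induction m arbitrary: s a)
  case 0
  then show ?case using zeta_reg_1_eq_0 by simp
next
  case (Suc m)
  have "integral {0..1} (\<lambda>y. of_real (1 - y) * zeta_reg (Suc m) (s + 1) (a + y))
      = integral {0..1} (\<lambda>y. of_real (1 - y) * zeta_reg m (s + 1) (a + y))"
    by (rule integral_cong, subst Suc.IH) (use Suc.prems in auto)
  then show ?case by (simp only: zeta_reg.simps(2)[of "Suc m"] zeta_reg.simps(2)[of m s a])
qed

lemma zeta_reg_stable:
  assumes "1 - real m < Re s" "0 < a" "m \<le> k"
  shows "zeta_reg k s a = zeta_reg m s a"
  using assms(3)
proof (induction k rule: dec_induct)
  case (step k)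
  then show ?case using zeta_reg_Suc_eq[of k s a] assms by simp
qed simp

section \<open>Identification with the zeta function and the remainder formula\<close>

text \<open>The levels agree on common half-planes, hence glue to one function \<open>F\<close>. It
  meets the three conditions in the definition of \<open>riemann_zeta\<close>, and the identity
  theorem makes it the only such function.\<close>

lemma riemann_zeta_eq:
  assumes "1 - real m < Re s" "s \<noteq> 1"
  shows "riemann_zeta s = zeta_reg m s 1 / (s - 1)"
proof -
  \<comment> \<open>Any level above \<open>1 - Re s\<close> is meaningful at \<open>s\<close>; this
    choice is at least \<open>2 - Re s\<close>.\<close>
  define k where "k = (\<lambda>s. nat \<lceil>2 - Re s\<rceil>)"
  define F where "F = (\<lambda>s. if s = 1 then 0 else zeta_reg (k s) s 1 / (s - 1))"
  have k: "1 - real (k s) < Re s" for s unfolding k_def by linarith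
  have F_eq: "F s = zeta_reg m s 1 / (s - 1)" if "1 - real m < Re s" "s \<noteq> 1" for s m
  proof -
    have "zeta_reg (k s) s 1 = zeta_reg m s 1"
      using zeta_reg_stable[OF k, of 1 s m] zeta_reg_stable[OF that(1), of 1 "k s"] by (cases "k s \<le> m") auto
    then show ?thesis using that(2) by (simp add: F_def)
  qed
  have hol: "F holomorphic_on - {1}"
  proof (rule holomorphic_onI)
    fix z :: complex assume z: "z \<in> - {1}"
    define m where "m = k z"
    obtain D where "((\<lambda>s. zeta_reg m s 1) has_field_derivative D z 1) (at z)"
      using zeta_reg_regular[of m] k[of z] unfolding m_def by (metis zero_less_one)
    then have "(\<lambda>s. zeta_reg m s 1) field_differentiable at z"
      unfolding field_differentiable_def by blast
    then have d: "(\<lambda>s. zeta_reg m s 1 / (s - 1)) field_differentiable at z"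
      using z by (intro field_differentiable_divide derivative_intros) auto
    \<comment> \<open>The level \<open>k s\<close> jumps as \<open>s\<close> varies, but near
      \<open>z\<close> the function \<open>F\<close> coincides with the fixed level
      \<open>m = k z\<close>.\<close>
    have "open ({s. 1 - real m < Re s} - {1})" by (intro open_delete open_halfspace_Re_gt)
    moreover have "z \<in> {s. 1 - real m < Re s} - {1}"
      using z k[of z] by (simp add: m_def)
    ultimately have "F field_differentiable at z"
      using d has_field_derivative_transform_within_open[of _ _ z "{s. 1 - real m < Re s} - {1}" F] F_eq
      unfolding field_differentiable_def by (metis (no_types, lifting) Diff_iff mem_Collect_eq singletonI)
    then show "F field_differentiable at z within - {1}" by (rule field_differentiable_at_within)
  qed
  have F1: "F s = (\<Sum>n. 1 / of_nat (Suc n) powr s)" if "1 < Re s" for s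
  proof -
    have "s \<noteq> 1" using that by auto
    then have "F s = (\<Sum>n. of_real (1 + real n) powr (- s))"
      using F_eq[of 0 s] that by simp
    also have "\<dots> = (\<Sum>n. 1 / of_nat (Suc n) powr s)"
      by (simp add: powr_minus_divide)
    finally show ?thesis .
  qed
  have "riemann_zeta = F"
    unfolding riemann_zeta_def
  proof (rule the_equality)
    show "F holomorphic_on - {1} \<and> (\<forall>s. 1 < Re s \<longrightarrow> F s = (\<Sum>n. 1 / of_nat (Suc n) powr s)) \<and> F 1 = 0"
      using hol F1 by (simp add: F_def)
  next
    fix f :: "complex \<Rightarrow> complex"
    assume f: "f holomorphic_on - {1} \<and> (\<forall>s. 1 < Re s \<longrightarrow> f s = (\<Sum>n. 1 / of_nat (Suc n) powr s)) \<and> f 1 = 0"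
    show "f = F"
    proof
      fix z show "f z = F z"
      proof (cases "z = 1")
        case False
        show ?thesis
        proof (rule analytic_continuation_open[of "{s. 1 < Re s}" "- {1}" f F])
          show "open {s. 1 < Re s}" by (rule open_halfspace_Re_gt)
          show "connected (- {1 :: complex})" by (rule connected_punctured_universe) simp
          show "{s. 1 < Re s} \<noteq> {}" by (auto intro: exI[of _ 2])
        qed (use f hol F1 False in auto)
      qed (use f in \<open>simp add: F_def\<close>)
    qed
  qed
  then show ?thesis using F_eq[OF assms] by simp
qed

text \<open>This is \<open>N\<close> shifts starting from \<open>a = 1\<close>: the summand with
  index \<open>n\<close> belongs to the integer \<open>n + 1\<close>, so the remainder sits at
  \<open>N + 1\<close>.\<close>

lemma riemann_zeta_minus_partial_sum:
  assumes "1 - real m < Re s" "s \<noteq> 1"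
  shows "riemann_zeta s - (\<Sum>n\<in>{1..N}. 1 / of_nat n powr s) = zeta_reg m s (real N + 1) / (s - 1)"
proof -
  have "(\<Sum>n<N. complex_of_real (1 + real n) powr (- s)) = (\<Sum>n\<in>{1..N}. 1 / of_nat n powr s)"
    by (simp add: powr_minus_divide sum.atLeast1_atMost_eq)
  then show ?thesis
    using riemann_zeta_eq[OF assms] zeta_reg_shift_nat[OF assms(1), of 1 N] assms(2)
    by (simp del: zeta_reg.simps add: field_simps)
qed

section \<open>The two estimates\<close>

lemma norm_riemann_zeta_minus_partial_sum_le:
  fixes x :: real
  assumes \<sigma>: "0 \<le> Re s" and s1: "2 \<le> norm (s - 1)" and x: "0 < x" "x \<le> norm s"
  shows "norm (riemann_zeta s - (\<Sum>n | 1 \<le> n \<and> real n \<le> x. 1 / of_nat n powr s))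
    \<le> 7 * norm s * x powr (- Re s)"
proof -
  define M where "M = nat \<lfloor>norm s\<rfloor>"
  define N where "N = real M + 1"
  let ?f = "\<lambda>n. 1 / of_nat n powr s :: complex"
  have s: "1 \<le> norm s" using s1 norm_triangle_ineq4[of s 1] by simp
  have sp: "norm (s + 1) \<le> 2 * norm s" using s norm_triangle_ineq[of s 1] by simp
  have M: "real M \<le> norm s" unfolding M_def using s by linarith
  have N: "norm s \<le> N" "1 \<le> N" unfolding N_def M_def using s by linarith+
  have "s \<noteq> 1" using s1 by auto
  have Nx: "N powr (- Re s) \<le> x powr (- Re s)"
    using \<sigma> x N by (intro powr_mono2') auto

  \<comment> \<open>At \<open>s + 2\<close> the real part is at least \<open>2\<close>, so the
    series converges absolutely even for \<open>Re s = 0\<close>. The factor \<open>1 / N\<close> is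
    kept in order to cancel a factor \<open>norm s\<close> one level up.\<close>
  have Z0: "norm (zeta_reg 0 (s + 2) b) \<le> norm (s + 1) * (2 / N * N powr (- Re s))" if b: "N \<le> b" for b
  proof -
    have e: "s + 2 - 1 = s + 1" "- Re (s + 2) = - Re s - 2" "1 - Re (s + 2) = - Re s - 1"
      "Re (s + 2) - 1 = Re s + 1" by auto
    have "norm (zeta_reg 0 (s + 2) b)
        \<le> norm (s + 1) * (b powr (- Re s - 2) + b powr (- Re s - 1) / (Re s + 1))"
      using norm_zeta_reg_0_le[of b "s + 2"] b N \<sigma> unfolding e by simp
    also have "b powr (- Re s - 2) + b powr (- Re s - 1) / (Re s + 1) \<le> N powr (- Re s - 1) + N powr (- Re s - 1)"
    proof (rule add_mono)
      have "b powr (- Re s - 2) \<le> b powr (- Re s - 1)" using b N by (intro powr_mono) auto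
      moreover have le: "b powr (- Re s - 1) \<le> N powr (- Re s - 1)" using b N \<sigma> by (intro powr_mono2') auto
      ultimately show "b powr (- Re s - 2) \<le> N powr (- Re s - 1)" by linarith
      have "b powr (- Re s - 1) / (Re s + 1) \<le> b powr (- Re s - 1) / 1"
        using \<sigma> by (intro divide_left_mono) auto
      with le show "b powr (- Re s - 1) / (Re s + 1) \<le> N powr (- Re s - 1)" by simp
    qed
    also have "\<dots> = 2 / N * N powr (- Re s)"
      using N by (simp add: powr_diff)
    finally show ?thesis by (simp add: mult_left_mono)
  qed
  have Z1: "norm (zeta_reg (Suc 0) (s + 1) b) \<le> 5 * norm s * N powr (- Re s)" if b: "N \<le> b" for b
  proof -
    have "norm (zeta_reg (Suc 0) (s + 1) b) \<le> b powr (1 - Re (s + 1)) +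
        norm (s + 1 - 1) * (norm (s + 1) * (2 / N * N powr (- Re s)))"
      using b N \<sigma> Z0 by (intro norm_zeta_reg_Suc_le) (auto simp del: zeta_reg.simps simp: add.assoc)
    also have "\<dots> = b powr (- Re s) + (norm s / N) * (2 * norm (s + 1) * N powr (- Re s))"
      by simp
    \<comment> \<open>Here \<open>norm s \<le> N\<close> gives the cancellation, and
      \<open>norm (s + 1) \<le> 2 * norm s\<close> turns the constant \<open>2\<close> into
      \<open>4\<close>. The leading term raises it to \<open>5\<close>, as
      \<open>1 \<le> norm s\<close>.\<close>
    also have "\<dots> \<le> N powr (- Re s) + 1 * (4 * norm s * N powr (- Re s))"
    proof (rule add_mono)
      show "b powr (- Re s) \<le> N powr (- Re s)" using b N \<sigma> by (intro powr_mono2') auto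
      show "(norm s / N) * (2 * norm (s + 1) * N powr (- Re s)) \<le> 1 * (4 * norm s * N powr (- Re s))"
      proof (rule mult_mono)
        show "2 * norm (s + 1) * N powr (- Re s) \<le> 4 * norm s * N powr (- Re s)"
          using sp by (intro mult_right_mono) auto
      qed (use N in auto)
    qed
    also have "\<dots> = (1 + 4 * norm s) * N powr (- Re s)" by (simp add: algebra_simps)
    also have "\<dots> \<le> 5 * norm s * N powr (- Re s)" using s by (intro mult_right_mono) auto
    finally show ?thesis .
  qed
  have "norm (zeta_reg (Suc (Suc 0)) s N) \<le> N powr (1 - Re s) + norm (s - 1) * (5 * norm s * N powr (- Re s))"
    using N \<sigma> Z1 by (intro norm_zeta_reg_Suc_le) (auto simp del: zeta_reg.simps)
  also have "\<dots> \<le> norm (s - 1) * norm s * N powr (- Re s) + norm (s - 1) * (5 * norm s * N powr (- Re s))"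
  proof (rule add_right_mono)
    \<comment> \<open>The hypothesis \<open>2 \<le> norm (s - 1)\<close> lets the leading power be
      absorbed with constant \<open>1\<close>; together with \<open>5\<close> this makes
      \<open>6\<close> after division by \<open>s - 1\<close>.\<close>
    have "N \<le> 2 * norm s" using M s by (simp add: N_def)
    also have "\<dots> \<le> norm (s - 1) * norm s" using s1 by (intro mult_right_mono) auto
    finally have "N * N powr (- Re s) \<le> norm (s - 1) * norm s * N powr (- Re s)"
      by (intro mult_right_mono) auto
    moreover have "N powr (1 - Re s) = N * N powr (- Re s)"
      using N powr_add[of N 1 "- Re s"] by simp
    ultimately show "N powr (1 - Re s) \<le> norm (s - 1) * norm s * N powr (- Re s)" by simp
  qed
  also have "\<dots> = norm (s - 1) * (6 * norm s * N powr (- Re s))" by (simp add: algebra_simps)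
  finally have "norm (zeta_reg (Suc (Suc 0)) s N / (s - 1)) \<le> 6 * norm s * N powr (- Re s)"
    using \<open>s \<noteq> 1\<close> by (simp del: zeta_reg.simps add: norm_divide pos_divide_le_eq mult.commute)
  also have "\<dots> \<le> 6 * norm s * x powr (- Re s)" using Nx by (intro mult_left_mono) auto
  finally have main: "norm (riemann_zeta s - (\<Sum>n\<in>{1..M}. ?f n)) \<le> 6 * norm s * x powr (- Re s)"
    using riemann_zeta_minus_partial_sum[of "Suc (Suc 0)" s M] \<sigma> \<open>s \<noteq> 1\<close>
    by (simp del: zeta_reg.simps add: N_def)

  let ?A = "{n. 1 \<le> n \<and> real n \<le> x}"
  have sub: "?A \<subseteq> {1..M}" using x by (auto simp: M_def le_nat_floor)
  \<comment> \<open>The integers between \<open>x\<close> and \<open>M\<close> number at most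
    \<open>M \<le> norm s\<close>, which supplies the seventh multiple of
    \<open>norm s\<close>.\<close>
  have "norm (\<Sum>n\<in>{1..M} - ?A. ?f n) \<le> (\<Sum>n\<in>{1..M} - ?A. x powr (- Re s))"
  proof (rule sum_norm_le)
    fix n assume n: "n \<in> {1..M} - ?A"
    then have "x \<le> real n" by auto
    have "norm (?f n) = real n powr (- Re s)"
      using n norm_of_real_powr[of "real n" "- s"] by (simp add: powr_minus_divide)
    also have "\<dots> \<le> x powr (- Re s)" using \<sigma> x \<open>x \<le> real n\<close> by (intro powr_mono2') auto
    finally show "norm (?f n) \<le> x powr (- Re s)" .
  qed
  also have "\<dots> \<le> real M * x powr (- Re s)"
    using card_mono[of "{1..M}" "{1..M} - ?A"] by (auto intro!: mult_right_mono)
  also have "\<dots> \<le> norm s * x powr (- Re s)" using M by (intro mult_right_mono) auto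
  finally have rest: "norm (\<Sum>n\<in>{1..M} - ?A. ?f n) \<le> norm s * x powr (- Re s)" .
  have eq: "riemann_zeta s - (\<Sum>n\<in>?A. ?f n)
      = (riemann_zeta s - (\<Sum>n\<in>{1..M}. ?f n)) + (\<Sum>n\<in>{1..M} - ?A. ?f n)"
    using sum.subset_diff[OF sub, of ?f] by simp
  show ?thesis
    unfolding eq
    using norm_triangle_ineq[of "riemann_zeta s - (\<Sum>n\<in>{1..M}. ?f n)" "\<Sum>n\<in>{1..M} - ?A. ?f n"] main rest
    by linarith
qed

text \<open>Level \<open>0\<close> already applies, so the integral comparison bounds the remainder
  at \<open>N\<close>. Both resulting powers decrease in the base, so \<open>N\<close> may be
  replaced by \<open>x\<close>.\<close>

lemma norm_riemann_zeta_minus_partial_sum_le_abs_conv: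
  fixes x :: real
  assumes s: "1 < Re s" and x: "0 < x"
  shows "norm (riemann_zeta s - (\<Sum>n | 1 \<le> n \<and> real n \<le> x. 1 / of_nat n powr s))
    \<le> x powr (1 - Re s) / (Re s - 1) * (1 + (Re s - 1) / x)"
proof -
  \<comment> \<open>For \<open>x < 1\<close> this gives \<open>M = 0\<close> and
    \<open>N = 1\<close>, with an empty sum.\<close>
  define M where "M = nat \<lfloor>x\<rfloor>"
  define N where "N = real M + 1"
  have N: "x \<le> N" unfolding N_def M_def using x by linarith
  have "s \<noteq> 1" using s by auto
  have "{n. 1 \<le> n \<and> real n \<le> x} = {1..M}"
    using x by (auto simp: M_def le_nat_floor) linarith
  then have "riemann_zeta s - (\<Sum>n | 1 \<le> n \<and> real n \<le> x. 1 / of_nat n powr s) = zeta_reg 0 s N / (s - 1)"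
    using riemann_zeta_minus_partial_sum[of 0 s M] s \<open>s \<noteq> 1\<close> by (simp del: zeta_reg.simps add: N_def)
  also have "norm \<dots> \<le> N powr (- Re s) + N powr (1 - Re s) / (Re s - 1)"
    using norm_zeta_reg_0_le[of N s] N x s \<open>s \<noteq> 1\<close>
    by (simp del: zeta_reg.simps add: norm_divide pos_divide_le_eq mult.commute)
  also have "\<dots> \<le> x powr (- Re s) + x powr (1 - Re s) / (Re s - 1)"
    using N x s by (intro add_mono divide_right_mono powr_mono2') auto
  also have "x powr (- Re s) = x powr (1 - Re s) / x"
    using x powr_diff[of x "1 - Re s" 1] by simp
  also have "x powr (1 - Re s) / x + x powr (1 - Re s) / (Re s - 1)
      = x powr (1 - Re s) / (Re s - 1) * (1 + (Re s - 1) / x)"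
    using x s by (simp add: field_simps)
  finally show ?thesis .
qed

theorem proposition14:
  fixes s :: complex and \<sigma> t :: real
  assumes "s = Complex \<sigma> t"
  shows "(\<forall>x::real. \<sigma> \<ge> 0 \<and> norm (s - 1) \<ge> 2 \<and> 0 < x \<and> x \<le> norm s \<longrightarrow>
            norm (riemann_zeta s - (\<Sum>n::nat | 1 \<le> n \<and> real n \<le> x. 1 / of_nat n powr s))
              \<le> 7 * norm s * x powr (- \<sigma>)) \<and>
         (\<forall>x::real. \<sigma> > 1 \<and> x > 0 \<longrightarrow>
            norm (riemann_zeta s - (\<Sum>n::nat | 1 \<le> n \<and> real n \<le> x. 1 / of_nat n powr s))
              \<le> x powr (1 - \<sigma>) / (\<sigma> - 1) * (1 + (\<sigma> - 1) / x))"
proof -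
  have "Re s = \<sigma>" using assms by simp
  then show ?thesis
    using norm_riemann_zeta_minus_partial_sum_le[of s] norm_riemann_zeta_minus_partial_sum_le_abs_conv[of s] by blast
qed

end
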